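(* Consider the multi-server speed-scaling problem described in the context with power function $P(s)=s^\alpha$ for some $\alpha\in(1,2)$. Consider the online algorithm that at every time $t$ serves, on $\min\{m,n(t)\}$ distinct servers, the $\min\{m,n(t)\}$ unfinished jobs with the shortest remaining sizes (SRPT, with migration allowed), where $n(t)$ is the number of unfinished jobs at time $t$; each busy server runs at speed $P^{-1}(n(t)/m)=(n(t)/m)^{1/\alpha}$ if $n(t)\ge m$ and at speed $P^{-1}(1)=1$ if $n(t)<m$, and idle servers run at speed $0$. Then this algorithm is $c$-competitive with $$c=3+\frac{2}{2-\alpha}.$$
   Context: There are $m$ identical servers, each of which can run at any speed $s\ge 0$ at power consumption $P(s)$; work is processed at rate $s$. A (finite) input instance $\sigma$ consists of jobs $j$ with release times $a_j$ and sizes $w_j>0$. Preemption and migration are allowed, but a job may be processed by at most one server at any time. The cost of a schedule is $C=\int n(t)\,dt+\int\sum_{k=1}^m P(s_k(t))\,dt$, where $n(t)$ is the number of released, unfinished jobs at time $t$ and $s_k(t)$ is the speed of server $k$. An online algorithm learns of job $j$ only at time $a_j$. $\mathsf{OPT}$ denotes the offline optimal schedule, which knows $\sigma$ in advance and minimizes $C$. An online algorithm $A$ is $c$-competitive if $C_A(\sigma)\le c\,C_{\mathsf{OPT}}(\sigma)$ for every input instance $\sigma$. *)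

theory Defs
  imports "HOL-Analysis.Analysis"
begin

text \<open>
  Model.  Jobs are indexed by 0..<N with release times a j and sizes w j.
  There are m servers indexed by 0..<m.  A schedule is a pair (sp, asg):
  sp k t is the speed of server k at time t, and asg t k is the job
  (if any) that server k processes at time t.
\<close>

definition rate :: "nat \<Rightarrow> (nat \<Rightarrow> real \<Rightarrow> real) \<Rightarrow> (real \<Rightarrow> nat \<Rightarrow> nat option) \<Rightarrow> nat \<Rightarrow> real \<Rightarrow> real" where
  "rate m sp asg j t = (\<Sum>k<m. if asg t k = Some j then sp k t else 0)"

definition processed :: "(nat \<Rightarrow> real) \<Rightarrow> nat \<Rightarrow> (nat \<Rightarrow> real \<Rightarrow> real) \<Rightarrow> (real \<Rightarrow> nat \<Rightarrow> nat option) \<Rightarrow> nat \<Rightarrow> real \<Rightarrow> ennreal" where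
  "processed a m sp asg j t = (\<integral>\<^sup>+ s\<in>{a j..t}. ennreal (rate m sp asg j s) \<partial>lborel)"

definition unfinished :: "nat \<Rightarrow> (nat \<Rightarrow> real) \<Rightarrow> (nat \<Rightarrow> real) \<Rightarrow> nat \<Rightarrow> (nat \<Rightarrow> real \<Rightarrow> real) \<Rightarrow> (real \<Rightarrow> nat \<Rightarrow> nat option) \<Rightarrow> real \<Rightarrow> nat set" where
  "unfinished N a w m sp asg t = {j. j < N \<and> a j \<le> t \<and> processed a m sp asg j t < ennreal (w j)}"

definition num_alive :: "nat \<Rightarrow> (nat \<Rightarrow> real) \<Rightarrow> (nat \<Rightarrow> real) \<Rightarrow> nat \<Rightarrow> (nat \<Rightarrow> real \<Rightarrow> real) \<Rightarrow> (real \<Rightarrow> nat \<Rightarrow> nat option) \<Rightarrow> real \<Rightarrow> nat" where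
  "num_alive N a w m sp asg t = card (unfinished N a w m sp asg t)"

text \<open>Remaining size of job j at time t (meaningful for unfinished jobs).\<close>
definition remaining :: "(nat \<Rightarrow> real) \<Rightarrow> (nat \<Rightarrow> real) \<Rightarrow> nat \<Rightarrow> (nat \<Rightarrow> real \<Rightarrow> real) \<Rightarrow> (real \<Rightarrow> nat \<Rightarrow> nat option) \<Rightarrow> nat \<Rightarrow> real \<Rightarrow> real" where
  "remaining a w m sp asg j t = w j - enn2real (processed a m sp asg j t)"

definition feasible_schedule :: "nat \<Rightarrow> (nat \<Rightarrow> real) \<Rightarrow> nat \<Rightarrow> (nat \<Rightarrow> real \<Rightarrow> real) \<Rightarrow> (real \<Rightarrow> nat \<Rightarrow> nat option) \<Rightarrow> bool" where
  "feasible_schedule N a m sp asg \<longleftrightarrow>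
     (\<forall>k<m. \<forall>t. 0 \<le> sp k t) \<and>
     (\<forall>k<m. sp k \<in> borel_measurable borel) \<and>
     (\<forall>j<N. rate m sp asg j \<in> borel_measurable borel) \<and>
     (\<forall>t k1 k2 j. k1 < m \<longrightarrow> k2 < m \<longrightarrow> asg t k1 = Some j \<longrightarrow> asg t k2 = Some j \<longrightarrow> k1 = k2) \<and>
     (\<forall>t k j. k < m \<longrightarrow> asg t k = Some j \<longrightarrow> j < N \<and> a j \<le> t)"

definition cost :: "(real \<Rightarrow> real) \<Rightarrow> nat \<Rightarrow> (nat \<Rightarrow> real) \<Rightarrow> (nat \<Rightarrow> real) \<Rightarrow> nat \<Rightarrow> (nat \<Rightarrow> real \<Rightarrow> real) \<Rightarrow> (real \<Rightarrow> nat \<Rightarrow> nat option) \<Rightarrow> ennreal" where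
  "cost P N a w m sp asg =
     (\<integral>\<^sup>+ t. ennreal (real (num_alive N a w m sp asg t) + (\<Sum>k<m. P (sp k t))) \<partial>lborel)"

definition srpt_rule :: "real \<Rightarrow> nat \<Rightarrow> (nat \<Rightarrow> real) \<Rightarrow> (nat \<Rightarrow> real) \<Rightarrow> nat \<Rightarrow> (nat \<Rightarrow> real \<Rightarrow> real) \<Rightarrow> (real \<Rightarrow> nat \<Rightarrow> nat option) \<Rightarrow> bool" where
  "srpt_rule alpha N a w m sp asg \<longleftrightarrow>
     (\<forall>t. let U = unfinished N a w m sp asg t;
             S = {j. \<exists>k<m. asg t k = Some j};
             n = card U
          in S \<subseteq> U \<and> card S = min m n \<and>
             (\<forall>j\<in>S. \<forall>i\<in>U - S. remaining a w m sp asg j t \<le> remaining a w m sp asg i t) \<and>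
             (\<forall>k<m. sp k t = (if asg t k = None then 0
                               else if m \<le> n then (real n / real m) powr (1 / alpha) else 1)))"

end

theory Submission
  imports Defs
begin

text \<open>
  Fix a size level \<open>q > 0\<close> and let \<open>D\<close> be the number of unfinished jobs with remaining size above
  \<open>q\<close> under SRPT minus the same number under the competing schedule. Arrivals leave \<open>D\<close> unchanged,
  an SRPT job crossing \<open>q\<close> decreases it, a job of the competitor crossing \<open>q\<close> increases it. With
  \<open>g l = \<alpha> (l/m) powr (1 - 1/\<alpha>)\<close> (zero for \<open>l \<le> 0\<close>), telescoping the potential \<open>\<Sum>l\<le>D. g l\<close> over
  the crossings of \<open>q\<close> gives: the sum of \<open>g (n - m + 1 - n')\<close> over the SRPT crossings is at most the
  sum of \<open>g n\<close> over the competitor's crossings, where \<open>n, n'\<close> count unfinished jobs at the crossing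
  time. SRPT enters here: at most \<open>m\<close> jobs have remaining size at most that of a served one.

  Integrating over \<open>q\<close> turns crossings into work: if \<open>R, R'\<close> are the total rates spent on unfinished
  jobs, then \<open>\<integral> (\<alpha> + g (n - m + 1 - n')) R \<le> \<integral> (\<alpha> + g n) R'\<close>, as the competitor finishes every job.
  SRPT pays \<open>2 n\<close> at each time, and Young's inequality yields pointwise
  \<open>n + (\<alpha> + g n) R' \<le> c (n' + \<Sum>P) + (\<alpha> + g (n - m + 1 - n')) R\<close> with \<open>c = max 2 (2 \<alpha> - 1)\<close>.
  So SRPT is \<open>2 c\<close>-competitive for every \<open>\<alpha> > 1\<close>, and \<open>2 c \<le> 3 + 2 / (2 - \<alpha>)\<close> if \<open>\<alpha> < 2\<close>.
\<close>

subsection \<open>Crossings of a level\<close>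

lemma sum_greaterThanAtMost_int_plus1:
  fixes g :: "int \<Rightarrow> 'a::comm_monoid_add"
  assumes "\<And>l. l \<le> 0 \<Longrightarrow> g l = 0"
  shows "(\<Sum>l\<in>{0<..x + 1}. g l) = (\<Sum>l\<in>{0<..x}. g l) + g (x + 1)"
proof (cases "0 \<le> x")
  case True
  then have "{0<..x + 1} = insert (x + 1) {0<..x}" by auto
  then show ?thesis by (simp add: add.commute)
qed (simp add: assms)

lemma last_event_cases:
  fixes x :: "'i \<Rightarrow> 't::linorder" and y :: "'j \<Rightarrow> 't"
  assumes "finite A" "finite B"
  obtains (none) "A = {}" "B = {}"
    | (left) i where "i \<in> A" "\<forall>i'\<in>A. x i' \<le> x i" "\<forall>j\<in>B. y j < x i"
    | (right) j where "j \<in> B" "\<forall>j'\<in>B. y j' \<le> y j" "\<forall>i\<in>A. x i \<le> y j"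
proof (cases "A = {} \<and> B = {}")
  case False
  define T where "T = Max (x ` A \<union> y ` B)"
  have "T \<in> x ` A \<union> y ` B" unfolding T_def by (rule Max_in) (use assms False in auto)
  moreover have "z \<le> T" if "z \<in> x ` A \<union> y ` B" for z
    unfolding T_def by (rule Max_ge) (use assms that in auto)
  ultimately show ?thesis
    by (cases "T \<in> y ` B") (force intro: right, force intro: left simp: order_less_le)
qed (simp add: none)

text \<open>Events of \<open>J\<close> are ordered after simultaneous events of \<open>I\<close>.\<close>
definition initial_segment ::
    "('i \<Rightarrow> 't::linorder) \<Rightarrow> ('j \<Rightarrow> 't) \<Rightarrow> 'i set \<Rightarrow> 'j set \<Rightarrow> 'i set \<Rightarrow> 'j set \<Rightarrow> bool" where
  "initial_segment x y I J A B \<longleftrightarrow> A \<subseteq> I \<and> B \<subseteq> J \<and>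
     (\<forall>i\<in>A. {j\<in>J. y j < x i} \<subseteq> B) \<and> (\<forall>j\<in>B. {i\<in>I. x i \<le> y j} \<subseteq> A)"

lemma initial_segment_remove_left:
  assumes "initial_segment x y I J A B" "\<forall>j\<in>B. y j < x i"
  shows "initial_segment x y I J (A - {i}) B"
  using assms by (fastforce simp: initial_segment_def)

lemma initial_segment_remove_right:
  assumes "initial_segment x y I J A B" "\<forall>i\<in>A. x i \<le> y j"
  shows "initial_segment x y I J A (B - {j})"
  using assms by (fastforce simp: initial_segment_def)

lemma last_left_event_counts:
  assumes "initial_segment x y I J A B" "finite I" "finite B"
    and "i \<in> A" "\<forall>i'\<in>A. x i' \<le> x i"
  shows "card {j\<in>J. y j < x i} \<le> card B" "card A \<le> card {i'\<in>I. x i' \<le> x i}"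
  using assms by (auto simp: initial_segment_def intro!: card_mono)

lemma last_right_event_counts:
  assumes "initial_segment x y I J A B" "finite J" "finite A"
    and "j \<in> B" "\<forall>j'\<in>B. y j' \<le> y j"
  shows "card B \<le> card {j'\<in>J. y j' \<le> y j}" "card {i\<in>I. x i \<le> y j} \<le> card A"
  using assms by (auto simp: initial_segment_def intro!: card_mono)

lemma potential_plus_sum_initial_segment_le:
  fixes g :: "int \<Rightarrow> 'a::linordered_idom" and x :: "'i \<Rightarrow> 't::linorder" and y :: "'j \<Rightarrow> 't"
  assumes mono: "mono g" and zero: "\<And>l. l \<le> 0 \<Longrightarrow> g l = 0"
    and finite: "finite I" "finite J"
    and h_le: "\<And>i. i \<in> I \<Longrightarrow>
      h i \<le> g (int (card {j\<in>J. y j < x i}) - int (card {i'\<in>I. x i' \<le> x i}) + 1)"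
    and k_ge: "\<And>j. j \<in> J \<Longrightarrow>
      g (int (card {j'\<in>J. y j' \<le> y j}) - int (card {i\<in>I. x i \<le> y j})) \<le> k j"
    and "initial_segment x y I J A B"
  shows "(\<Sum>l\<in>{0<..int (card B) - int (card A)}. g l) + sum h A \<le> sum k B"
  using assms(7)
proof (induction "card A + card B" arbitrary: A B rule: less_induct)
  case less
  define potential where "potential z = (\<Sum>l\<in>{0<..z}. g l)" for z
  have potential_plus1: "potential (z + 1) = potential z + g (z + 1)" for z
    unfolding potential_def by (rule sum_greaterThanAtMost_int_plus1[OF zero])
  have subsets: "A \<subseteq> I" "B \<subseteq> J" using less.prems by (auto simp: initial_segment_def)
  then have finite_AB: "finite A" "finite B" using finite by (auto intro: finite_subset)
  then show ?case
  proof (cases rule: last_event_cases[where x = x and y = y])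
    case none
    then show ?thesis by simp
  next
    case (left i)
    have "card A = Suc (card (A - {i}))" using finite_AB left(1) by (simp only: card_Suc_Diff1)
    then have "potential (int (card B) - int (card A) + 1) + sum h (A - {i}) \<le> sum k B"
      using less.hyps[OF _ initial_segment_remove_left[OF less.prems left(3)]]
      by (simp add: potential_def)
    moreover have "h i \<le> g (int (card B) - int (card A) + 1)"
      using last_left_event_counts[OF less.prems finite(1) finite_AB(2) left(1,2)] subsets left(1)
      by (intro order_trans[OF h_le] monoD[OF mono]) auto
    ultimately show ?thesis
      using sum.remove[OF finite_AB(1) left(1), of h] by (simp add: potential_plus1 flip: potential_def)
  next
    case (right j)
    have "card B = Suc (card (B - {j}))" using finite_AB right(1) by (simp only: card_Suc_Diff1)
    then have "potential (int (card B) - int (card A) - 1) + sum h A \<le> sum k (B - {j})"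
      using less.hyps[OF _ initial_segment_remove_right[OF less.prems right(3)]]
      by (simp add: potential_def)
    moreover have "g (int (card B) - int (card A)) \<le> k j"
      using last_right_event_counts[OF less.prems finite(2) finite_AB(1) right(1,2)] subsets right(1)
      by (intro order_trans[OF monoD[OF mono] k_ge]) auto
    ultimately show ?thesis
      using sum.remove[OF finite_AB(2) right(1), of k] potential_plus1[of "int (card B) - int (card A) - 1"]
      by (simp flip: potential_def)
  qed
qed

corollary sum_crossings_le:
  fixes g :: "int \<Rightarrow> 'a::linordered_idom" and x :: "'i \<Rightarrow> 't::linorder" and y :: "'j \<Rightarrow> 't"
  assumes mono: "mono g" and zero: "\<And>l. l \<le> 0 \<Longrightarrow> g l = 0"
    and "finite I" "finite J"
    and "\<And>i. i \<in> I \<Longrightarrow>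
      h i \<le> g (int (card {j\<in>J. y j < x i}) - int (card {i'\<in>I. x i' \<le> x i}) + 1)"
    and "\<And>j. j \<in> J \<Longrightarrow>
      g (int (card {j'\<in>J. y j' \<le> y j}) - int (card {i\<in>I. x i \<le> y j})) \<le> k j"
  shows "sum h I \<le> sum k J"
proof -
  have "(\<Sum>l\<in>{0<..int (card J) - int (card I)}. g l) + sum h I \<le> sum k J"
    by (rule potential_plus_sum_initial_segment_le[OF assms]) (auto simp: initial_segment_def)
  moreover have "0 \<le> (\<Sum>l\<in>{0<..int (card J) - int (card I)}. g l)"
    using monoD[OF mono, of 0] zero[of 0] by (intro sum_nonneg) auto
  ultimately show ?thesis by simp
qed

subsection \<open>Work on a single job\<close>

locale workload =
  fixes \<rho> :: "real \<Rightarrow> real" and a w :: real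
  assumes measurable_rate [measurable]: "\<rho> \<in> borel_measurable borel"
    and rate_nonneg: "\<And>t. 0 \<le> \<rho> t"
    and rate_eq_0: "\<And>t. t < a \<Longrightarrow> \<rho> t = 0"
    and finite_work: "\<And>t. (\<integral>\<^sup>+ s\<in>{a..t}. ennreal (\<rho> s) \<partial>lborel) < \<infinity>"
begin

definition rem_size :: "real \<Rightarrow> real" where
  "rem_size t = w - enn2real (\<integral>\<^sup>+ s\<in>{a..t}. ennreal (\<rho> s) \<partial>lborel)"

text \<open>The levels include negative ones if a job is processed beyond its size.\<close>
definition levels :: "real set" where
  "levels = {q. q < w \<and> (\<exists>t. rem_size t \<le> q)}"

definition crossing_time :: "real \<Rightarrow> real" where
  "crossing_time q = Inf {t. rem_size t \<le> q}"

lemma levelsI: "rem_size t \<le> q \<Longrightarrow> q < w \<Longrightarrow> q \<in> levels"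
  by (auto simp: levels_def)

lemma work_eq: "(\<integral>\<^sup>+ s\<in>{a..t}. ennreal (\<rho> s) \<partial>lborel) = ennreal (w - rem_size t)"
  using finite_work[of t] by (simp add: rem_size_def)

lemma rem_size_le: "rem_size t \<le> w"
  by (simp add: rem_size_def)

lemma work_less_iff: "(\<integral>\<^sup>+ s\<in>{a..t}. ennreal (\<rho> s) \<partial>lborel) < ennreal w \<longleftrightarrow> 0 < rem_size t"
  unfolding work_eq using rem_size_le[of t] by (subst ennreal_less_iff) auto

lemma rem_size_antimono: "antimono rem_size"
  unfolding rem_size_def using finite_work
  by (auto intro!: antimonoI enn2real_mono nn_integral_mono simp: indicator_def)

lemma nn_integral_indicator_mult:
  "(\<integral>\<^sup>+ s. ennreal (indicator {a..t} s * \<rho> s) \<partial>lborel) = (\<integral>\<^sup>+ s\<in>{a..t}. ennreal (\<rho> s) \<partial>lborel)"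
  by (intro nn_integral_cong) (simp add: indicator_def)

lemma set_integrable_rate: "set_integrable lborel {a..t} \<rho>"
  unfolding set_integrable_def using finite_work[of t]
  by (intro integrableI_nonneg) (auto simp: rate_nonneg nn_integral_indicator_mult)

lemma rem_size_eq_integral: "rem_size t = w - integral {a..t} \<rho>"
proof -
  have "(LINT s:{a..t}|lborel. \<rho> s) = enn2real (\<integral>\<^sup>+ s\<in>{a..t}. ennreal (\<rho> s) \<partial>lborel)"
    unfolding set_lebesgue_integral_def
    by (subst integral_eq_nn_integral) (auto simp: rate_nonneg nn_integral_indicator_mult)
  then show ?thesis
    using set_borel_integral_eq_integral(2)[OF set_integrable_rate] by (simp add: rem_size_def)
qed

lemma rem_size_early: "t \<le> a \<Longrightarrow> rem_size t = w"
  unfolding rem_size_eq_integral by (cases "t = a") auto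

lemma continuous_on_rem_size: "continuous_on UNIV rem_size"
proof -
  have "isCont rem_size t" for t
  proof -
    define b where "b = max a t + 1"
    have "continuous_on {a..b} (\<lambda>x. integral {a..x} \<rho>)"
      using set_borel_integral_eq_integral(1)[OF set_integrable_rate]
      by (rule indefinite_integral_continuous_1)
    then have "continuous_on {..<b} (\<lambda>x. w - integral {a..max a x} \<rho>)"
      by (intro continuous_intros continuous_on_compose2[where f = "max a"]) (auto simp: b_def)
    then have "continuous_on {..<b} rem_size"
      by (rule continuous_on_eq) (auto simp: rem_size_early max_def simp flip: rem_size_eq_integral)
    then show ?thesis
      by (simp add: continuous_on_eq_continuous_at b_def)
  qed
  then show ?thesis by (simp add: continuous_on_eq_continuous_at)
qed

lemma measurable_rem_size [measurable]: "rem_size \<in> borel_measurable borel"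
  using continuous_on_rem_size by (rule borel_measurable_continuous_onI)

lemma crossing_time_le_iff:
  assumes "q \<in> levels"
  shows "crossing_time q \<le> t \<longleftrightarrow> rem_size t \<le> q"
proof -
  let ?X = "{t. rem_size t \<le> q}"
  have "closed ?X" using continuous_on_rem_size by (intro closed_Collect_le) auto
  have bdd: "bdd_below ?X"
    by (rule bdd_belowI[of _ a])
       (use assms rem_size_early in \<open>force simp: levels_def intro: leI dest: less_imp_le\<close>)
  have "crossing_time q \<in> ?X"
    unfolding crossing_time_def using assms \<open>closed ?X\<close> bdd
    by (intro closed_contains_Inf) (auto simp: levels_def)
  then show ?thesis
    using antimonoD[OF rem_size_antimono, of "crossing_time q" t] bdd
    by (auto simp: crossing_time_def intro!: cInf_lower)
qed

lemma rem_size_crossing_time: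
  assumes "q \<in> levels"
  shows "rem_size (crossing_time q) = q"
proof (rule antisym)
  show "rem_size (crossing_time q) \<le> q"
    using crossing_time_le_iff[OF assms, of "crossing_time q"] by simp
  obtain t where "rem_size t \<le> q" "q < w" using assms by (auto simp: levels_def)
  then have "\<exists>x\<ge>min a t. x \<le> t \<and> rem_size x = q"
    using continuous_on_rem_size rem_size_early[of "min a t"]
    by (intro IVT2') (auto intro: continuous_on_subset)
  then obtain x where rem_size_x: "rem_size x = q" by auto
  then have "crossing_time q \<le> x" using crossing_time_le_iff[OF assms, of x] rem_size_x by simp
  then show "q \<le> rem_size (crossing_time q)"
    using antimonoD[OF rem_size_antimono, of "crossing_time q" x] rem_size_x by simp
qed

lemma measurable_levels [measurable]: "levels \<in> sets borel"
  by (rule real_interval_borel_measurable) (auto simp: is_interval_1 levels_def intro: order_trans)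

lemma levels_crossed_by: "{q \<in> levels. crossing_time q \<le> t} = {rem_size t..<w}"
proof -
  have "q \<in> levels \<and> crossing_time q \<le> t \<longleftrightarrow> q < w \<and> rem_size t \<le> q" for q
    using crossing_time_le_iff by (auto simp: levels_def)
  then show ?thesis by (simp add: set_eq_iff conj_commute)
qed

lemma measurable_crossing_time [measurable]:
  "crossing_time \<in> borel_measurable (restrict_space lborel levels)"
proof (rule borel_measurableI_le)
  show "{q \<in> space (restrict_space lborel levels). crossing_time q \<le> t}
      \<in> sets (restrict_space lborel levels)" for t
    using levels_crossed_by[of t]
    by (subst sets_restrict_space_iff) (auto simp: space_restrict_space)
qed

lemma distr_crossing_time:
  "distr (restrict_space lborel levels) borel crossing_time = density lborel (\<lambda>t. ennreal (\<rho> t))"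
  (is "?M = ?N")
proof (rule measure_eqI_generator_eq
    [where E = "range (\<lambda>t. {..t})" and \<Omega> = UNIV and A = "\<lambda>n. {..real n}"])
  show "Int_stable (range (\<lambda>t::real. {..t}))"
    by (auto simp: Int_stable_def)
  show "sets ?M = sigma_sets UNIV (range (\<lambda>t. {..t}))"
    and "sets ?N = sigma_sets UNIV (range (\<lambda>t. {..t}))"
    by (simp_all add: borel_eq_atMost)
  have distr_atMost: "emeasure ?M {..t} = ennreal (w - rem_size t)" for t
  proof -
    have "emeasure ?M {..t} = emeasure lborel (crossing_time -` {..t} \<inter> levels)"
      by (subst emeasure_distr) (auto simp: space_restrict_space emeasure_restrict_space)
    also have "crossing_time -` {..t} \<inter> levels = {rem_size t..<w}"
      using levels_crossed_by[of t] by auto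
    finally show ?thesis using rem_size_le[of t] by simp
  qed
  have density_atMost: "emeasure ?N {..t} = ennreal (w - rem_size t)" for t
  proof -
    have "emeasure ?N {..t} = (\<integral>\<^sup>+ s\<in>{a..t}. ennreal (\<rho> s) \<partial>lborel)"
      using rate_eq_0
      by (subst emeasure_density) (auto intro!: nn_integral_cong simp: indicator_def not_le)
    then show ?thesis by (simp only: work_eq)
  qed
  show "emeasure ?M X = emeasure ?N X" if "X \<in> range (\<lambda>t. {..t})" for X
    using that by (auto simp: distr_atMost density_atMost)
  show "emeasure ?M {..real n} \<noteq> \<infinity>" for n
    by (simp add: distr_atMost)
qed (auto intro: real_arch_simple)

lemma measurable_comp_crossing_time [measurable]:
  assumes "h \<in> borel_measurable borel"
  shows "(\<lambda>q. h (crossing_time q) * indicator levels q :: ennreal) \<in> borel_measurable borel"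
  using measurable_compose[OF measurable_crossing_time assms]
  by (subst (asm) borel_measurable_restrict_space_iff_ennreal) auto

lemma nn_integral_crossing_time:
  assumes [measurable]: "h \<in> borel_measurable borel"
  shows "(\<integral>\<^sup>+ q\<in>levels. h (crossing_time q) \<partial>lborel) = (\<integral>\<^sup>+ t. ennreal (\<rho> t) * h t \<partial>lborel)"
proof -
  have "(\<integral>\<^sup>+ q\<in>levels. h (crossing_time q) \<partial>lborel)
      = (\<integral>\<^sup>+ t. h t \<partial>distr (restrict_space lborel levels) borel crossing_time)"
    by (subst nn_integral_distr) (auto simp: nn_integral_restrict_space)
  then show ?thesis
    by (simp add: distr_crossing_time nn_integral_density)
qed

text \<open>A job that rests at a level does so at some rational time.\<close>
lemma crossing_time_unique:
  assumes irrational: "q \<notin> rem_size ` \<rat>" and rem_size_t: "rem_size t = q"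
  shows "q \<in> levels" "crossing_time q = t"
proof -
  obtain r where "r \<in> \<rat>" "r < a" using Rats_dense_in_real[of "a - 1" a] by auto
  then have "w \<in> rem_size ` \<rat>" using rem_size_early[of r] by force
  then have "q \<noteq> w" using irrational by blast
  then show level: "q \<in> levels" using rem_size_le[of t] rem_size_t by (auto intro: levelsI)
  have "\<not> crossing_time q < t"
  proof
    assume "crossing_time q < t"
    then obtain r where r: "r \<in> \<rat>" "crossing_time q < r" "r < t"
      using Rats_dense_in_real by blast
    then have "rem_size r = q"
      using level rem_size_t crossing_time_le_iff[of q r] antimonoD[OF rem_size_antimono, of r t] by simp
    with r(1) irrational show False by auto
  qed
  moreover have "crossing_time q \<le> t" using level rem_size_t by (simp add: crossing_time_le_iff)
  ultimately show "crossing_time q = t" by simp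
qed

lemma AE_rate_pos_at_level: "AE q in lborel. \<forall>t. rem_size t = q \<longrightarrow> 0 < \<rho> t"
proof -
  have "AE t in distr (restrict_space lborel levels) borel crossing_time. 0 < \<rho> t"
    unfolding distr_crossing_time by (subst AE_density) (auto simp: order_less_le rate_nonneg)
  then have "AE q in lborel. q \<in> levels \<longrightarrow> 0 < \<rho> (crossing_time q)"
    by (subst (asm) AE_distr_iff) (auto simp: AE_restrict_space_iff)
  moreover have "AE q in lborel. q \<notin> rem_size ` \<rat>"
    by (intro AE_not_in countable_imp_null_set_lborel countable_image countable_rat)
  ultimately show ?thesis
  proof eventually_elim
    case (elim q)
    then show ?case using crossing_time_unique by metis
  qed
qed

end

subsection \<open>The amortized running cost\<close>

lemma Young_powr:
  fixes \<alpha> s x :: real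
  assumes "1 < \<alpha>" "0 \<le> s" "0 \<le> x"
  shows "\<alpha> * x powr (1 - 1 / \<alpha>) * s \<le> s powr \<alpha> + (\<alpha> - 1) * x"
proof -
  define b where "b = x powr (1 - 1 / \<alpha>)"
  have "b powr (\<alpha> / (\<alpha> - 1)) = x"
    using assms by (simp add: b_def powr_powr field_simps)
  then have "s * b \<le> s powr \<alpha> / \<alpha> + x / (\<alpha> / (\<alpha> - 1))"
    using Youngs_inequality[of \<alpha> "\<alpha> / (\<alpha> - 1)" s b] assms
    by (simp add: b_def field_simps)
  then have "\<alpha> * (s * b) \<le> \<alpha> * (s powr \<alpha> / \<alpha> + x / (\<alpha> / (\<alpha> - 1)))"
    using assms by (intro mult_left_mono) auto
  also have "\<dots> = s powr \<alpha> + (\<alpha> - 1) * x"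
    using assms by (simp add: field_simps)
  finally show ?thesis by (simp add: b_def mult_ac)
qed

lemma sum_Young_powr:
  fixes s :: "'k \<Rightarrow> real"
  assumes "1 < \<alpha>" "\<And>k. k \<in> K \<Longrightarrow> 0 \<le> s k" "0 \<le> x"
  shows "\<alpha> * x powr (1 - 1 / \<alpha>) * sum s K \<le> (\<Sum>k\<in>K. s k powr \<alpha>) + (\<alpha> - 1) * (real (card K) * x)"
proof -
  have "\<alpha> * x powr (1 - 1 / \<alpha>) * sum s K = (\<Sum>k\<in>K. \<alpha> * x powr (1 - 1 / \<alpha>) * s k)"
    by (rule sum_distrib_left)
  also have "\<dots> \<le> (\<Sum>k\<in>K. s k powr \<alpha> + (\<alpha> - 1) * x)"
    using assms by (intro sum_mono Young_powr) auto
  also have "\<dots> = (\<Sum>k\<in>K. s k powr \<alpha>) + (\<alpha> - 1) * (real (card K) * x)"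
    by (simp add: sum.distrib)
  finally show ?thesis .
qed

text \<open>The derivative of \<open>\<lambda>s. s powr \<alpha>\<close> at the speed whose power is \<open>max 0 l / m\<close>.\<close>
definition marginal_power :: "real \<Rightarrow> nat \<Rightarrow> int \<Rightarrow> real" where
  "marginal_power \<alpha> m l = \<alpha> * (max 0 (real_of_int l) / real m) powr (1 - 1 / \<alpha>)"

lemma marginal_power_nonpos: "l \<le> 0 \<Longrightarrow> marginal_power \<alpha> m l = 0"
  by (simp add: marginal_power_def)

lemma marginal_power_nonneg: "0 \<le> \<alpha> \<Longrightarrow> 0 \<le> marginal_power \<alpha> m l"
  by (simp add: marginal_power_def)

lemma mono_marginal_power: "1 \<le> \<alpha> \<Longrightarrow> mono (marginal_power \<alpha> m)"
  unfolding marginal_power_def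
  by (intro monoI mult_left_mono powr_mono2 divide_right_mono) auto

lemma weighted_speed_sum_le:
  fixes s :: "nat \<Rightarrow> real"
  assumes \<alpha>: "1 < \<alpha>" and K: "K \<subseteq> {..<m}" and s: "\<And>k. k < m \<Longrightarrow> 0 \<le> s k"
  shows "(\<alpha> + marginal_power \<alpha> m (int n)) * sum s K
    \<le> 2 * (\<Sum>k<m. s k powr \<alpha>) + (\<alpha> - 1) * (real (card K) * (1 + real n / real m))"
proof -
  have "(\<Sum>k\<in>K. s k powr \<alpha>) \<le> (\<Sum>k<m. s k powr \<alpha>)"
    using K by (intro sum_mono2) auto
  then have "\<alpha> * x powr (1 - 1 / \<alpha>) * sum s K
      \<le> (\<Sum>k<m. s k powr \<alpha>) + (\<alpha> - 1) * (real (card K) * x)" if "0 \<le> x" for x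
    using sum_Young_powr[of \<alpha> K s x] \<alpha> K s that by fastforce
  from this[of 1] this[of "real n / real m"] show ?thesis
    by (simp add: marginal_power_def algebra_simps)
qed

definition srpt_speed :: "real \<Rightarrow> nat \<Rightarrow> nat \<Rightarrow> real" where
  "srpt_speed \<alpha> m n = (if m \<le> n then (real n / real m) powr (1 / \<alpha>) else 1)"

lemma srpt_speed_powr:
  assumes "0 < m" "\<alpha> \<noteq> 0"
  shows "real (min m n) * srpt_speed \<alpha> m n powr \<alpha> = real n"
  using assms by (simp add: srpt_speed_def powr_powr)

lemma weighted_srpt_work_ge:
  fixes n n' m :: nat
  assumes "1 < \<alpha>" "0 < m" "m \<le> n"
  defines "R \<equiv> real (min m n) * srpt_speed \<alpha> m n"
  shows "\<alpha> * (real n - real n') \<le> (\<alpha> + marginal_power \<alpha> m (int n - int m + 1 - int n')) * R"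
proof -
  define y where "y = real n / real m"
  define v where "v = max 0 (real n - real m + 1 - real n') / real m"
  have R_eq: "R = real m * y powr (1 / \<alpha>)"
    using assms by (simp add: R_def srpt_speed_def y_def)
  have "1 \<le> y" using assms by (simp add: y_def)
  have v_bounds: "0 \<le> v" "v \<le> y"
    using assms unfolding v_def y_def by (auto intro!: divide_right_mono)
  have "v = v powr (1 / \<alpha>) * v powr (1 - 1 / \<alpha>)"
    using v_bounds by (simp flip: powr_add)
  also have "\<dots> \<le> y powr (1 / \<alpha>) * v powr (1 - 1 / \<alpha>)"
    using v_bounds assms by (intro mult_right_mono powr_mono2) auto
  finally have "real m * (\<alpha> * v) \<le> real m * (\<alpha> * (y powr (1 / \<alpha>) * v powr (1 - 1 / \<alpha>)))"
    using assms by (intro mult_left_mono) auto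
  also have "\<dots> = marginal_power \<alpha> m (int n - int m + 1 - int n') * R"
    by (simp add: marginal_power_def R_eq v_def algebra_simps)
  finally have marginal_part:
    "\<alpha> * (real m * v) \<le> marginal_power \<alpha> m (int n - int m + 1 - int n') * R"
    by (simp add: mult_ac)
  have "1 \<le> y powr (1 / \<alpha>)" using \<open>1 \<le> y\<close> assms by (intro ge_one_powr_ge_zero) auto
  then have constant_part: "\<alpha> * real m \<le> \<alpha> * R"
    using assms(1,2) by (simp add: R_eq)
  have "real n - real n' \<le> real m + real m * v"
    using assms by (simp add: v_def)
  then have "\<alpha> * (real n - real n') \<le> \<alpha> * (real m + real m * v)"
    using assms by (intro mult_left_mono) auto
  with marginal_part constant_part show ?thesis by (simp add: algebra_simps)
qed

lemma amortized_running_cost_le: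
  fixes s :: "nat \<Rightarrow> real" and n n' m :: nat
  assumes \<alpha>: "1 < \<alpha>" and m: "0 < m" and s: "\<And>k. k < m \<Longrightarrow> 0 \<le> s k"
    and K: "K \<subseteq> {..<m}" "card K \<le> n'"
  defines "R \<equiv> real (min m n) * srpt_speed \<alpha> m n"
  shows "real n + (\<alpha> + marginal_power \<alpha> m (int n)) * sum s K
    \<le> max 2 (2 * \<alpha> - 1) * (real n' + (\<Sum>k<m. s k powr \<alpha>))
      + (\<alpha> + marginal_power \<alpha> m (int n - int m + 1 - int n')) * R"
proof -
  define energy where "energy = (\<Sum>k<m. s k powr \<alpha>)"
  have "0 \<le> energy" unfolding energy_def by (intro sum_nonneg) auto
  then have ratio: "2 * energy + (2 * \<alpha> - 1) * real n' \<le> max 2 (2 * \<alpha> - 1) * (real n' + energy)"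
    by (subst distrib_left, subst add.commute, intro add_mono mult_right_mono) auto
  have weighted: "(\<alpha> + marginal_power \<alpha> m (int n)) * sum s K
      \<le> 2 * energy + (\<alpha> - 1) * (real (card K) * (1 + real n / real m))"
    unfolding energy_def using \<alpha> K(1) s by (rule weighted_speed_sum_le)
  have card_K: "real (card K) \<le> real m" "real (card K) \<le> real n'"
    using card_mono[OF _ K(1)] K(2) by auto
  show ?thesis
  proof (cases "m \<le> n")
    case True
    have "real (card K) * (real n / real m) \<le> real m * (real n / real m)"
      using card_K(1) by (intro mult_right_mono) auto
    then have "real (card K) * (1 + real n / real m) \<le> real n' + real n"
      using card_K(2) m by (simp add: algebra_simps)
    then have "(\<alpha> - 1) * (real (card K) * (1 + real n / real m)) \<le> (\<alpha> - 1) * (real n' + real n)"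
      using \<alpha> by (intro mult_left_mono) auto
    moreover have "\<alpha> * (real n - real n')
        \<le> (\<alpha> + marginal_power \<alpha> m (int n - int m + 1 - int n')) * R"
      unfolding R_def using \<alpha> m True by (rule weighted_srpt_work_ge)
    ultimately show ?thesis
      using ratio weighted unfolding energy_def[symmetric] by (simp add: algebra_simps)
  next
    case False
    have "real (card K) * (1 + real n / real m) \<le> real n' * 2"
      using False m card_K(2) by (intro mult_mono) auto
    then have "(\<alpha> - 1) * (real (card K) * (1 + real n / real m)) \<le> (\<alpha> - 1) * (real n' * 2)"
      using \<alpha> by (intro mult_left_mono) auto
    moreover have "1 * R \<le> (\<alpha> + marginal_power \<alpha> m (int n - int m + 1 - int n')) * R"
      using marginal_power_nonneg[of \<alpha>] \<alpha> unfolding R_def srpt_speed_def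
      by (intro mult_right_mono add_increasing2) auto
    moreover have "R = real n" using False by (simp add: R_def srpt_speed_def)
    ultimately show ?thesis
      using ratio weighted unfolding energy_def[symmetric] by (simp add: algebra_simps)
  qed
qed

lemma max_le_competitive_ratio:
  fixes \<alpha> :: real
  assumes "1 < \<alpha>" "\<alpha> < 2"
  shows "2 * max 2 (2 * \<alpha> - 1) \<le> 3 + 2 / (2 - \<alpha>)"
proof -
  have "4 \<le> 3 + 2 / (2 - \<alpha>)" using assms by (simp add: field_simps)
  moreover have "4 * \<alpha> - 2 \<le> 3 + 2 / (2 - \<alpha>)"
  proof -
    have "0 \<le> (2 * (2 - \<alpha>) - 3 / 4)\<^sup>2" by simp
    then have "(4 * \<alpha> - 5) * (2 - \<alpha>) \<le> 2"
      using assms by (simp add: power2_eq_square algebra_simps)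
    then have "4 * \<alpha> - 5 \<le> 2 / (2 - \<alpha>)" using assms by (simp add: pos_le_divide_eq)
    then show ?thesis by simp
  qed
  ultimately show ?thesis by (simp add: max_def)
qed

subsection \<open>Schedules\<close>

locale server_schedule =
  fixes N m :: nat and a w :: "nat \<Rightarrow> real"
    and sp :: "nat \<Rightarrow> real \<Rightarrow> real" and asg :: "real \<Rightarrow> nat \<Rightarrow> nat option"
  assumes feasible: "feasible_schedule N a m sp asg"
begin

abbreviation "job_rate \<equiv> rate m sp asg"
abbreviation "alive \<equiv> unfinished N a w m sp asg"
abbreviation "rem \<equiv> remaining a w m sp asg"

lemma speed_nonneg: "k < m \<Longrightarrow> 0 \<le> sp k t"
  using feasible by (simp add: feasible_schedule_def)

lemma measurable_speed [measurable]: "k < m \<Longrightarrow> sp k \<in> borel_measurable borel"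
  using feasible by (simp add: feasible_schedule_def)

lemma measurable_energy [measurable]: "(\<lambda>t. \<Sum>k<m. sp k t powr \<alpha>) \<in> borel_measurable borel"
  by (intro borel_measurable_sum powr_real_measurable) auto

lemma asg_inj: "k < m \<Longrightarrow> k' < m \<Longrightarrow> asg t k = Some j \<Longrightarrow> asg t k' = Some j \<Longrightarrow> k = k'"
  using feasible unfolding feasible_schedule_def by blast

lemma job_rate_nonneg: "0 \<le> job_rate j t"
  unfolding rate_def using speed_nonneg by (intro sum_nonneg) auto

lemma job_rate_le: "job_rate j t \<le> (\<Sum>k<m. sp k t)"
  unfolding rate_def using speed_nonneg by (intro sum_mono) auto

lemma job_rate_eq_0: "N \<le> j \<or> t < a j \<Longrightarrow> job_rate j t = 0"
  unfolding rate_def using feasible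
  by (intro sum.neutral) (fastforce simp: feasible_schedule_def)

lemma measurable_job_rate [measurable]: "job_rate j \<in> borel_measurable borel"
proof (cases "j < N")
  case False
  then have "job_rate j = (\<lambda>_. 0)" using job_rate_eq_0 by auto
  then show ?thesis by simp
qed (use feasible in \<open>simp add: feasible_schedule_def\<close>)

lemma sum_job_rate:
  assumes "finite A"
  shows "(\<Sum>j\<in>A. job_rate j t) = (\<Sum>k | k < m \<and> asg t k \<in> Some ` A. sp k t)"
proof -
  have "(\<Sum>j\<in>A. job_rate j t) = (\<Sum>k<m. \<Sum>j\<in>A. if asg t k = Some j then sp k t else 0)"
    unfolding rate_def by (rule sum.swap)
  also have "\<dots> = (\<Sum>k<m. if asg t k \<in> Some ` A then sp k t else 0)"
  proof (rule sum.cong)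
    show "(\<Sum>j\<in>A. if asg t k = Some j then sp k t else 0)
        = (if asg t k \<in> Some ` A then sp k t else 0)" for k
      using assms by (cases "asg t k") (auto simp: sum.delta)
  qed simp
  also have "\<dots> = (\<Sum>k | k < m \<and> asg t k \<in> Some ` A. sp k t)"
    by (rule sum.mono_neutral_cong_right) auto
  finally show ?thesis .
qed

lemma alive_subset: "alive t \<subseteq> {..<N}"
  by (auto simp: unfinished_def)

lemma finite_alive [simp]: "finite (alive t)"
  using alive_subset finite_subset by blast

lemma card_alive_le: "card (alive t) \<le> N"
  using card_mono[OF _ alive_subset] by simp

definition useful_servers :: "real \<Rightarrow> nat set" where
  "useful_servers t = {k. k < m \<and> asg t k \<in> Some ` alive t}"

definition useful_rate :: "real \<Rightarrow> real" where
  "useful_rate t = (\<Sum>j\<in>alive t. job_rate j t)"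

lemma useful_rate_eq: "useful_rate t = (\<Sum>k\<in>useful_servers t. sp k t)"
  by (simp add: useful_rate_def useful_servers_def sum_job_rate)

lemma useful_rate_nonneg: "0 \<le> useful_rate t"
  unfolding useful_rate_def by (intro sum_nonneg job_rate_nonneg)

lemma useful_servers_subset: "useful_servers t \<subseteq> {..<m}"
  by (auto simp: useful_servers_def)

lemma inj_on_useful_servers: "inj_on (\<lambda>k. the (asg t k)) (useful_servers t)"
  using asg_inj by (auto simp: inj_on_def useful_servers_def)

lemma card_useful_servers_le: "card (useful_servers t) \<le> card (alive t)"
  by (rule card_inj_on_le[OF inj_on_useful_servers]) (auto simp: useful_servers_def)

lemma sum_speed_le_energy:
  assumes "1 < \<alpha>"
  shows "(\<Sum>k<m. sp k t) \<le> (\<Sum>k<m. sp k t powr \<alpha>) + (\<alpha> - 1) * real m"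
proof -
  have "1 * (\<Sum>k<m. sp k t) \<le> \<alpha> * (\<Sum>k<m. sp k t)"
    using assms speed_nonneg by (intro mult_right_mono sum_nonneg) auto
  then show ?thesis
    using sum_Young_powr[OF assms, of "{..<m}" "\<lambda>k. sp k t" 1] speed_nonneg by simp
qed

lemma finite_work_if_finite_energy:
  assumes "1 < \<alpha>" and "(\<integral>\<^sup>+ s\<in>{x..t}. ennreal (\<Sum>k<m. sp k s powr \<alpha>) \<partial>lborel) < \<infinity>"
  shows "(\<integral>\<^sup>+ s\<in>{x..t}. ennreal (\<Sum>k<m. sp k s) \<partial>lborel) < \<infinity>"
proof -
  let ?E = "\<lambda>s. \<Sum>k<m. sp k s powr \<alpha>" and ?c = "(\<alpha> - 1) * real m"
  have "(\<integral>\<^sup>+ s\<in>{x..t}. ennreal (\<Sum>k<m. sp k s) \<partial>lborel)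
      \<le> (\<integral>\<^sup>+ s. ennreal (?E s) * indicator {x..t} s + ennreal ?c * indicator {x..t} s \<partial>lborel)"
  proof (rule nn_integral_mono)
    fix s
    have "ennreal (\<Sum>k<m. sp k s) \<le> ennreal (?E s) + ennreal ?c"
      using sum_speed_le_energy[OF assms(1)] assms(1)
      by (subst ennreal_plus[symmetric]) (auto intro!: ennreal_leI sum_nonneg)
    then show "ennreal (\<Sum>k<m. sp k s) * indicator {x..t} s
        \<le> ennreal (?E s) * indicator {x..t} s + ennreal ?c * indicator {x..t} s"
      by (simp add: indicator_def)
  qed
  also have "\<dots> = (\<integral>\<^sup>+ s\<in>{x..t}. ennreal (?E s) \<partial>lborel) + (\<integral>\<^sup>+ s\<in>{x..t}. ennreal ?c \<partial>lborel)"
    by (rule nn_integral_add) auto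
  also have "\<dots> < \<infinity>"
    using assms(2) by (simp add: nn_integral_cmult emeasure_lborel_Icc_eq ennreal_mult_less_top)
  finally show ?thesis .
qed

end

locale locally_finite_schedule = server_schedule +
  assumes finite_work: "\<And>x t. (\<integral>\<^sup>+ s\<in>{x..t}. ennreal (\<Sum>k<m. sp k s) \<partial>lborel) < \<infinity>"
begin

sublocale job: workload "job_rate j" "a j" "w j"
  rewrites "workload.rem_size (job_rate j) (a j) (w j) = rem j"
  for j
proof -
  have "(\<integral>\<^sup>+ s\<in>{a j..t}. ennreal (job_rate j s) \<partial>lborel)
      \<le> (\<integral>\<^sup>+ s\<in>{a j..t}. ennreal (\<Sum>k<m. sp k s) \<partial>lborel)" for j t
    by (intro nn_integral_mono mult_right_mono ennreal_leI job_rate_le) auto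
  then have "(\<integral>\<^sup>+ s\<in>{a j..t}. ennreal (job_rate j s) \<partial>lborel) < \<infinity>" for j t
    using finite_work by (rule le_less_trans)
  then show workload: "workload (job_rate j) (a j)" for j
    using job_rate_nonneg job_rate_eq_0 by unfold_locales auto
  show "workload.rem_size (job_rate j) (a j) (w j) = rem j"
    by (simp add: fun_eq_iff workload.rem_size_def[OF workload] remaining_def processed_def)
qed

lemma alive_iff: "j \<in> alive t \<longleftrightarrow> j < N \<and> a j \<le> t \<and> 0 < rem j t"
  using job.work_less_iff[of j t] by (auto simp: unfinished_def processed_def)

lemma useful_rate_eq_sum_lessThan:
  "useful_rate t = (\<Sum>j<N. job_rate j t * indicator {t. 0 < rem j t} t)"
  unfolding useful_rate_def
  by (rule sum.mono_neutral_cong_left) (auto simp: alive_iff indicator_def job_rate_eq_0 not_le)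

lemma measurable_useful_rate [measurable]: "useful_rate \<in> borel_measurable borel"
  unfolding useful_rate_eq_sum_lessThan[abs_def] by measurable

lemma measurable_card_alive [measurable]:
  "(\<lambda>t. card (alive t)) \<in> measurable borel (count_space UNIV)"
proof -
  have "card (alive t) = (\<Sum>j<N. if a j \<le> t \<and> 0 < rem j t then 1 else 0)" for t
    by (subst card_eq_sum, rule sum.mono_neutral_cong_left) (auto simp: alive_iff)
  then show ?thesis by simp
qed

definition crossing_jobs :: "real \<Rightarrow> nat set" where
  "crossing_jobs q = {j. j < N \<and> q \<in> job.levels j}"

lemma crossing_jobs_subset: "crossing_jobs q \<subseteq> {j. j < N \<and> q < w j}"
  by (auto simp: crossing_jobs_def job.levels_def)

lemma finite_crossing_jobs [simp]: "finite (crossing_jobs q)"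
  by (simp add: crossing_jobs_def)

lemma nn_integral_useful_rate:
  assumes [measurable]: "h \<in> borel_measurable borel"
  shows "(\<integral>\<^sup>+ t. ennreal (useful_rate t) * h t \<partial>lborel)
    = (\<Sum>j<N. \<integral>\<^sup>+ q. h (job.crossing_time j q) * indicator (job.levels j) q
        * indicator {0<..} q \<partial>lborel)"
proof -
  have "ennreal (useful_rate t) * h t
      = (\<Sum>j<N. ennreal (job_rate j t) * (indicator {t. 0 < rem j t} t * h t))" for t
  proof -
    have "ennreal (useful_rate t) = (\<Sum>j<N. ennreal (job_rate j t * indicator {t. 0 < rem j t} t))"
      unfolding useful_rate_eq_sum_lessThan
      by (rule sum_ennreal[symmetric]) (simp add: job_rate_nonneg)
    also have "\<dots> = (\<Sum>j<N. ennreal (job_rate j t) * indicator {t. 0 < rem j t} t)"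
      by (intro sum.cong) (auto simp: indicator_def)
    finally show ?thesis by (simp only: sum_distrib_right mult.assoc)
  qed
  then have "(\<integral>\<^sup>+ t. ennreal (useful_rate t) * h t \<partial>lborel)
      = (\<Sum>j<N. \<integral>\<^sup>+ t. ennreal (job_rate j t) * (indicator {t. 0 < rem j t} t * h t) \<partial>lborel)"
    by (simp, intro nn_integral_sum) auto
  also have "\<dots> = (\<Sum>j<N. \<integral>\<^sup>+ q\<in>job.levels j. indicator {t. 0 < rem j t} (job.crossing_time j q)
      * h (job.crossing_time j q) \<partial>lborel)"
    by (intro sum.cong refl job.nn_integral_crossing_time[symmetric]) simp
  also have "\<dots> = (\<Sum>j<N. \<integral>\<^sup>+ q. h (job.crossing_time j q) * indicator (job.levels j) q
      * indicator {0<..} q \<partial>lborel)"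
    by (intro sum.cong refl nn_integral_cong)
       (auto simp: indicator_def job.rem_size_crossing_time)
  finally show ?thesis .
qed

lemma nn_integral_useful_rate_levels:
  assumes [measurable]: "h \<in> borel_measurable borel"
  shows "(\<integral>\<^sup>+ t. ennreal (useful_rate t) * h t \<partial>lborel)
    = (\<integral>\<^sup>+ q\<in>{0<..}. (\<Sum>j\<in>crossing_jobs q. h (job.crossing_time j q)) \<partial>lborel)"
proof -
  have "(\<integral>\<^sup>+ t. ennreal (useful_rate t) * h t \<partial>lborel)
      = (\<integral>\<^sup>+ q. (\<Sum>j<N. h (job.crossing_time j q) * indicator (job.levels j) q
          * indicator {0<..} q) \<partial>lborel)"
    unfolding nn_integral_useful_rate[OF assms] by (rule nn_integral_sum[symmetric]) simp
  also have "\<dots> = (\<integral>\<^sup>+ q\<in>{0<..}. (\<Sum>j\<in>crossing_jobs q. h (job.crossing_time j q)) \<partial>lborel)"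
    unfolding sum_distrib_right crossing_jobs_def
    by (intro nn_integral_cong sum.mono_neutral_cong_right) (auto simp: indicator_def)
  finally show ?thesis .
qed

lemma total_useful_work_le: "(\<integral>\<^sup>+ t. ennreal (useful_rate t) \<partial>lborel) \<le> (\<Sum>j<N. ennreal (w j))"
proof -
  have "(\<integral>\<^sup>+ q. indicator (job.levels j) q * indicator {0<..} q \<partial>lborel) \<le> ennreal (w j)" for j
  proof -
    have "(\<integral>\<^sup>+ q. indicator (job.levels j) q * indicator {0<..} q \<partial>lborel)
        \<le> (\<integral>\<^sup>+ q. indicator {0..w j} q \<partial>lborel)"
      by (intro nn_integral_mono) (auto simp: job.levels_def indicator_def)
    also have "\<dots> \<le> ennreal (w j)" by (simp add: emeasure_lborel_Icc_eq)
    finally show ?thesis .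
  qed
  then show ?thesis
    using nn_integral_useful_rate[of "\<lambda>_. 1"] by (auto intro!: sum_mono)
qed

lemma card_crossed:
  assumes "0 < q"
  shows "card {j\<in>crossing_jobs q. job.crossing_time j q \<le> t} + card {j\<in>alive t. q < rem j t}
    + card {j. j < N \<and> t < a j \<and> q < w j} = card {j. j < N \<and> q < w j}"
proof -
  let ?X = "{j\<in>crossing_jobs q. job.crossing_time j q \<le> t}" and ?Y = "{j\<in>alive t. q < rem j t}"
    and ?Z = "{j. j < N \<and> t < a j \<and> q < w j}"
  have crossed_eq: "?X = {j. j < N \<and> q < w j \<and> rem j t \<le> q}"
    using job.levels_crossed_by[of _ t] by (auto simp: crossing_jobs_def set_eq_iff)
  have "{j. j < N \<and> q < w j} = (?X \<union> ?Y) \<union> ?Z"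
    unfolding crossed_eq using assms job.rem_size_le by (force simp: alive_iff not_le intro: less_le_trans)
  moreover have "?X \<inter> ?Y = {}" "(?X \<union> ?Y) \<inter> ?Z = {}"
    unfolding crossed_eq by (auto simp: alive_iff job.rem_size_early)
  ultimately show ?thesis by (simp add: card_Un_disjoint)
qed

lemma card_crossed_before_ge:
  assumes "0 < q"
  shows "card {j. j < N \<and> q < w j} \<le> card {j\<in>crossing_jobs q. job.crossing_time j q < t}
    + card (alive t) + card {j. j < N \<and> t < a j \<and> q < w j}"
proof -
  have "{j. j < N \<and> q < w j} \<subseteq> ({j\<in>crossing_jobs q. job.crossing_time j q < t} \<union> alive t)
      \<union> {j. j < N \<and> t < a j \<and> q < w j}" (is "_ \<subseteq> (?X \<union> ?Y) \<union> ?Z")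
  proof
    fix j assume "j \<in> {j. j < N \<and> q < w j}"
    moreover have "j \<in> ?X" if "j < N" "q < w j" "rem j t \<le> 0"
    proof -
      have level: "q \<in> job.levels j" using that assms by (intro job.levelsI[where t = t]) auto
      then have "job.crossing_time j q \<le> t" "job.crossing_time j q \<noteq> t"
        using that assms job.crossing_time_le_iff job.rem_size_crossing_time by force+
      then show ?thesis using level that by (simp add: crossing_jobs_def)
    qed
    ultimately show "j \<in> (?X \<union> ?Y) \<union> ?Z"
      by (cases "rem j t \<le> 0") (auto simp: alive_iff)
  qed
  then have "card {j. j < N \<and> q < w j} \<le> card ((?X \<union> ?Y) \<union> ?Z)"
    by (intro card_mono) auto
  also have "\<dots> \<le> card ?X + card ?Y + card ?Z"
    by (intro order_trans[OF card_Un_le] add_mono card_Un_le) auto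
  finally show ?thesis .
qed

end

locale finite_cost_schedule = server_schedule +
  fixes \<alpha> :: real
  assumes \<alpha>_gt_1: "1 < \<alpha>"
    and finite_cost: "cost (\<lambda>s. s powr \<alpha>) N a w m sp asg < \<infinity>"
begin

sublocale locally_finite_schedule
proof
  fix x t
  have "(\<integral>\<^sup>+ s\<in>{x..t}. ennreal (\<Sum>k<m. sp k s powr \<alpha>) \<partial>lborel) \<le> cost (\<lambda>s. s powr \<alpha>) N a w m sp asg"
    unfolding cost_def by (intro nn_integral_mono) (auto simp: indicator_def intro!: ennreal_leI)
  then show "(\<integral>\<^sup>+ s\<in>{x..t}. ennreal (\<Sum>k<m. sp k s) \<partial>lborel) < \<infinity>"
    using finite_cost by (intro finite_work_if_finite_energy[OF \<alpha>_gt_1]) (rule le_less_trans)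
qed

lemma job_finishes:
  assumes "j < N"
  shows "\<exists>t. rem j t \<le> 0"
proof (rule ccontr)
  assume "\<nexists>t. rem j t \<le> 0"
  then have alive: "j \<in> alive t" if "a j \<le> t" for t
    using that assms by (simp add: alive_iff not_le)
  have "1 \<le> real (num_alive N a w m sp asg t) + (\<Sum>k<m. sp k t powr \<alpha>)" if "a j \<le> t" for t
  proof -
    have "1 \<le> card (alive t)" using alive[OF that] by (auto simp: Suc_le_eq card_gt_0_iff)
    moreover have "0 \<le> (\<Sum>k<m. sp k t powr \<alpha>)" by (intro sum_nonneg) auto
    ultimately show ?thesis by (simp add: num_alive_def)
  qed
  then have "(\<integral>\<^sup>+ t. indicator {a j..a j + r} t \<partial>lborel) \<le> cost (\<lambda>s. s powr \<alpha>) N a w m sp asg" for r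
    unfolding cost_def using ennreal_leI[of 1]
    by (intro nn_integral_mono) (auto simp: indicator_def)
  then have cost_ge: "emeasure lborel {a j..a j + r} \<le> cost (\<lambda>s. s powr \<alpha>) N a w m sp asg" for r
    by simp
  obtain c where "0 \<le> c" "cost (\<lambda>s. s powr \<alpha>) N a w m sp asg = ennreal c"
    using finite_cost by (cases "cost (\<lambda>s. s powr \<alpha>) N a w m sp asg") auto
  with cost_ge[of "c + 1"] show False by simp
qed

lemma crossing_jobs_eq:
  assumes "0 < q"
  shows "crossing_jobs q = {j. j < N \<and> q < w j}"
proof -
  have "q \<in> job.levels j" if "j < N" "q < w j" for j
    using job_finishes[OF that(1)] that(2) assms by (meson job.levelsI less_imp_le order_trans)
  then show ?thesis using crossing_jobs_subset by (auto simp: crossing_jobs_def)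
qed

end

subsection \<open>SRPT\<close>

locale srpt_schedule = server_schedule +
  fixes \<alpha> :: real
  assumes \<alpha>_gt_1: "1 < \<alpha>" and m_pos: "0 < m"
    and srpt: "srpt_rule \<alpha> N a w m sp asg"
begin

abbreviation "num_jobs t \<equiv> card (alive t)"

definition served :: "real \<Rightarrow> nat set" where
  "served t = {j. \<exists>k<m. asg t k = Some j}"

lemma
  shows served_subset: "served t \<subseteq> alive t"
    and card_served: "card (served t) = min m (num_jobs t)"
    and served_shortest: "j \<in> served t \<Longrightarrow> i \<in> alive t - served t \<Longrightarrow> rem j t \<le> rem i t"
    and speed_srpt: "k < m \<Longrightarrow> sp k t = (if asg t k = None then 0 else srpt_speed \<alpha> m (num_jobs t))"
  using srpt unfolding srpt_rule_def Let_def served_def srpt_speed_def by simp_all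

lemma finite_served [simp]: "finite (served t)"
  by (rule finite_subset[OF served_subset]) simp

lemma served_if_rate_pos:
  assumes "0 < job_rate j t"
  shows "j \<in> served t"
proof (rule ccontr)
  assume "j \<notin> served t"
  then have "job_rate j t = 0" by (auto simp: rate_def served_def intro!: sum.neutral)
  with assms show False by simp
qed

lemma useful_servers_srpt: "useful_servers t = {k. k < m \<and> asg t k \<noteq> None}"
  using served_subset[of t] by (auto simp: useful_servers_def served_def)

lemma card_useful_servers: "card (useful_servers t) = min m (num_jobs t)"
proof -
  have "(\<lambda>k. the (asg t k)) ` useful_servers t = served t"
    by (force simp: useful_servers_srpt served_def)
  then have "card (useful_servers t) = card (served t)"
    using card_image[OF inj_on_useful_servers, of t] by simp
  then show ?thesis by (simp add: card_served)
qed

lemma sum_useful_servers: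
  "(\<Sum>k\<in>useful_servers t. f (sp k t)) = real (min m (num_jobs t)) * f (srpt_speed \<alpha> m (num_jobs t))"
proof -
  have "(\<Sum>k\<in>useful_servers t. f (sp k t)) = (\<Sum>k\<in>useful_servers t. f (srpt_speed \<alpha> m (num_jobs t)))"
    by (intro sum.cong) (auto simp: useful_servers_srpt speed_srpt)
  then show ?thesis by (simp add: card_useful_servers)
qed

lemma useful_rate_srpt:
  "useful_rate t = real (min m (num_jobs t)) * srpt_speed \<alpha> m (num_jobs t)"
  unfolding useful_rate_eq by (rule sum_useful_servers)

lemma energy_srpt: "(\<Sum>k<m. sp k t powr \<alpha>) = real (num_jobs t)"
proof -
  have "(\<Sum>k<m. sp k t powr \<alpha>) = (\<Sum>k\<in>useful_servers t. sp k t powr \<alpha>)"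
    using useful_servers_subset
    by (intro sum.mono_neutral_right) (auto simp: useful_servers_srpt speed_srpt)
  then show ?thesis
    using sum_useful_servers[of "\<lambda>s. s powr \<alpha>"] \<alpha>_gt_1 m_pos
    by (simp add: srpt_speed_powr del: of_nat_min)
qed

sublocale locally_finite_schedule
proof
  fix x t
  have "(\<integral>\<^sup>+ s\<in>{x..t}. ennreal (\<Sum>k<m. sp k s powr \<alpha>) \<partial>lborel)
      \<le> (\<integral>\<^sup>+ s\<in>{x..t}. ennreal (real N) \<partial>lborel)"
    unfolding energy_srpt
    by (intro nn_integral_mono mult_right_mono ennreal_leI) (auto simp: card_alive_le)
  also have "\<dots> < \<infinity>"
    by (simp add: nn_integral_cmult emeasure_lborel_Icc_eq ennreal_mult_less_top)
  finally show "(\<integral>\<^sup>+ s\<in>{x..t}. ennreal (\<Sum>k<m. sp k s) \<partial>lborel) < \<infinity>"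
    by (rule finite_work_if_finite_energy[OF \<alpha>_gt_1])
qed

lemma card_longer_than_served_ge:
  assumes "j \<in> served t" "\<And>i. i \<in> alive t \<Longrightarrow> rem i t = rem j t \<Longrightarrow> i \<in> served t"
  shows "num_jobs t \<le> m + card {i\<in>alive t. rem j t < rem i t}"
proof -
  have "alive t - served t \<subseteq> {i\<in>alive t. rem j t < rem i t}"
    using served_shortest[OF assms(1)] assms(2) by (force simp: order_less_le)
  then have "card (alive t - served t) \<le> card {i\<in>alive t. rem j t < rem i t}"
    by (intro card_mono) auto
  then show ?thesis
    using served_subset[of t] card_served[of t] by (simp add: card_Diff_subset)
qed

lemma cost_srpt:
  "cost (\<lambda>s. s powr \<alpha>) N a w m sp asg = 2 * (\<integral>\<^sup>+ t. ennreal (num_jobs t) \<partial>lborel)"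
proof -
  have "cost (\<lambda>s. s powr \<alpha>) N a w m sp asg = (\<integral>\<^sup>+ t. 2 * ennreal (num_jobs t) \<partial>lborel)"
    unfolding cost_def num_alive_def energy_srpt
    by (simp only: ennreal_plus mult_2 of_nat_0_le_iff)
  then show ?thesis by (simp add: nn_integral_cmult)
qed

end

subsection \<open>SRPT against an arbitrary schedule\<close>

lemma nn_integral_le_if_amortized:
  assumes [measurable]: "f \<in> borel_measurable M" "g \<in> borel_measurable M"
      "A \<in> borel_measurable M" "B \<in> borel_measurable M"
    and pointwise: "\<And>x. f x + B x \<le> g x + A x"
    and A_le_B: "(\<integral>\<^sup>+ x. A x \<partial>M) \<le> (\<integral>\<^sup>+ x. B x \<partial>M)" and finite_B: "(\<integral>\<^sup>+ x. B x \<partial>M) < \<infinity>"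
  shows "(\<integral>\<^sup>+ x. f x \<partial>M) \<le> (\<integral>\<^sup>+ x. g x \<partial>M)"
proof -
  have "(\<integral>\<^sup>+ x. B x \<partial>M) + (\<integral>\<^sup>+ x. f x \<partial>M) = (\<integral>\<^sup>+ x. f x + B x \<partial>M)"
    by (simp add: nn_integral_add add.commute)
  also have "\<dots> \<le> (\<integral>\<^sup>+ x. g x + A x \<partial>M)"
    by (intro nn_integral_mono pointwise)
  also have "\<dots> \<le> (\<integral>\<^sup>+ x. B x \<partial>M) + (\<integral>\<^sup>+ x. g x \<partial>M)"
    using A_le_B by (simp add: nn_integral_add add.commute add_left_mono)
  finally show ?thesis
    using finite_B by (simp add: ennreal_add_left_cancel_le less_top[symmetric])
qed

locale srpt_comparison =
  Alg: srpt_schedule N m a w sp asg \<alpha> + Opt: finite_cost_schedule N m a w sp' asg' \<alpha>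
  for N m :: nat and a w :: "nat \<Rightarrow> real"
    and sp sp' :: "nat \<Rightarrow> real \<Rightarrow> real" and asg asg' :: "real \<Rightarrow> nat \<Rightarrow> nat option" and \<alpha> :: real
begin

abbreviation "n t \<equiv> card (Alg.alive t)"
abbreviation "n' t \<equiv> card (Opt.alive t)"

abbreviation "alg_time \<equiv> Alg.job.crossing_time"
abbreviation "opt_time \<equiv> Opt.job.crossing_time"

abbreviation "alg_marginal t \<equiv> marginal_power \<alpha> m (int (n t) - int m + 1 - int (n' t))"
abbreviation "opt_marginal t \<equiv> marginal_power \<alpha> m (int (n t))"

definition alg_weight :: "real \<Rightarrow> real" where
  "alg_weight t = \<alpha> + alg_marginal t"

definition opt_weight :: "real \<Rightarrow> real" where
  "opt_weight t = \<alpha> + opt_marginal t"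

lemma measurable_weights [measurable]:
  "alg_weight \<in> borel_measurable borel" "opt_weight \<in> borel_measurable borel"
  unfolding alg_weight_def[abs_def] opt_weight_def[abs_def] marginal_power_def by simp_all

lemma weight_nonneg: "0 \<le> alg_weight t" "0 \<le> opt_weight t"
  using Alg.\<alpha>_gt_1 by (auto simp: alg_weight_def opt_weight_def marginal_power_nonneg)

lemma mono_marginal: "mono (marginal_power \<alpha> m)"
  using Alg.\<alpha>_gt_1 by (simp add: mono_marginal_power)

lemma running_cost_le:
  "real (n t) + opt_weight t * Opt.useful_rate t
    \<le> max 2 (2 * \<alpha> - 1) * (real (n' t) + (\<Sum>k<m. sp' k t powr \<alpha>)) + alg_weight t * Alg.useful_rate t"
  unfolding opt_weight_def alg_weight_def Opt.useful_rate_eq Alg.useful_rate_srpt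
  by (rule amortized_running_cost_le)
     (use Alg.\<alpha>_gt_1 Alg.m_pos Opt.speed_nonneg Opt.useful_servers_subset
        Opt.card_useful_servers_le in auto)

lemma sum_marginal_crossings_le:
  assumes q_pos: "0 < q" and rate_pos: "\<And>j t. Alg.rem j t = q \<Longrightarrow> 0 < Alg.job_rate j t"
  shows "(\<Sum>j\<in>Alg.crossing_jobs q. alg_marginal (alg_time j q))
    \<le> (\<Sum>j\<in>Opt.crossing_jobs q. opt_marginal (opt_time j q))"
proof (rule sum_crossings_le[OF mono_marginal marginal_power_nonpos])
  fix j assume j: "j \<in> Alg.crossing_jobs q"
  define t where "t = alg_time j q"
  have "Alg.rem j t = q"
    using j by (simp add: t_def Alg.crossing_jobs_def Alg.job.rem_size_crossing_time)
  then have "n t \<le> m + card {i\<in>Alg.alive t. q < Alg.rem i t}"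
    using Alg.card_longer_than_served_ge[of j t] Alg.served_if_rate_pos rate_pos by simp
  then have "int (n t) - int m + 1 - int (n' t)
      \<le> int (card {i\<in>Opt.crossing_jobs q. opt_time i q < t})
        - int (card {i\<in>Alg.crossing_jobs q. alg_time i q \<le> t}) + 1"
    using Alg.card_crossed[OF q_pos, of t] Opt.card_crossed_before_ge[OF q_pos, of t] by linarith
  then show "alg_marginal (alg_time j q)
      \<le> marginal_power \<alpha> m (int (card {i\<in>Opt.crossing_jobs q. opt_time i q < alg_time j q})
        - int (card {i\<in>Alg.crossing_jobs q. alg_time i q \<le> alg_time j q}) + 1)"
    unfolding t_def by (rule monoD[OF mono_marginal])
next
  fix j
  define t where "t = opt_time j q"
  have "card {i\<in>Alg.alive t. q < Alg.rem i t} \<le> n t" by (intro card_mono) auto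
  then have "int (card {i\<in>Opt.crossing_jobs q. opt_time i q \<le> t})
      - int (card {i\<in>Alg.crossing_jobs q. alg_time i q \<le> t}) \<le> int (n t)"
    using Alg.card_crossed[OF q_pos, of t] Opt.card_crossed[OF q_pos, of t] by linarith
  then show "marginal_power \<alpha> m (int (card {i\<in>Opt.crossing_jobs q. opt_time i q \<le> opt_time j q})
        - int (card {i\<in>Alg.crossing_jobs q. alg_time i q \<le> opt_time j q}))
      \<le> opt_marginal (opt_time j q)"
    unfolding t_def by (rule monoD[OF mono_marginal])
qed auto

lemma sum_weight_crossings_le:
  assumes q_pos: "0 < q" and rate_pos: "\<And>j t. Alg.rem j t = q \<Longrightarrow> 0 < Alg.job_rate j t"
  shows "(\<Sum>j\<in>Alg.crossing_jobs q. alg_weight (alg_time j q))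
    \<le> (\<Sum>j\<in>Opt.crossing_jobs q. opt_weight (opt_time j q))"
proof -
  have "Alg.crossing_jobs q \<subseteq> Opt.crossing_jobs q"
    unfolding Opt.crossing_jobs_eq[OF q_pos] by (rule Alg.crossing_jobs_subset)
  then have "(\<Sum>j\<in>Alg.crossing_jobs q. \<alpha>) \<le> (\<Sum>j\<in>Opt.crossing_jobs q. \<alpha>)"
    using Alg.\<alpha>_gt_1 by (intro sum_mono2) auto
  then show ?thesis
    unfolding alg_weight_def opt_weight_def sum.distrib
    using sum_marginal_crossings_le[OF assms] by (rule add_mono)
qed

lemma weighted_work_le:
  "(\<integral>\<^sup>+ t. ennreal (Alg.useful_rate t) * ennreal (alg_weight t) \<partial>lborel)
    \<le> (\<integral>\<^sup>+ t. ennreal (Opt.useful_rate t) * ennreal (opt_weight t) \<partial>lborel)"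
proof -
  have "AE q in lborel. \<forall>j t. Alg.rem j t = q \<longrightarrow> 0 < Alg.job_rate j t"
    using Alg.job.AE_rate_pos_at_level by (simp add: AE_all_countable)
  then have "AE q in lborel.
      (\<Sum>j\<in>Alg.crossing_jobs q. ennreal (alg_weight (alg_time j q))) * indicator {0<..} q
    \<le> (\<Sum>j\<in>Opt.crossing_jobs q. ennreal (opt_weight (opt_time j q))) * indicator {0<..} q"
  proof eventually_elim
    case (elim q)
    have "(\<Sum>j\<in>Alg.crossing_jobs q. ennreal (alg_weight (alg_time j q)))
      \<le> (\<Sum>j\<in>Opt.crossing_jobs q. ennreal (opt_weight (opt_time j q)))" if "0 < q"
      using sum_weight_crossings_le[OF that] elim
      by (simp only: sum_ennreal weight_nonneg) (auto intro: ennreal_leI)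
    then show ?case by (simp add: indicator_def)
  qed
  then show ?thesis
    by (subst Alg.nn_integral_useful_rate_levels Opt.nn_integral_useful_rate_levels, simp)+
       (rule nn_integral_mono_AE)
qed

lemma weighted_work_finite:
  "(\<integral>\<^sup>+ t. ennreal (Opt.useful_rate t) * ennreal (opt_weight t) \<partial>lborel) < \<infinity>"
proof -
  define C where "C = \<alpha> + marginal_power \<alpha> m (int N)"
  have "opt_weight t \<le> C" for t
    unfolding opt_weight_def C_def using Alg.card_alive_le
    by (intro add_left_mono monoD[OF mono_marginal]) simp
  then have "(\<integral>\<^sup>+ t. ennreal (Opt.useful_rate t) * ennreal (opt_weight t) \<partial>lborel)
      \<le> (\<integral>\<^sup>+ t. ennreal (Opt.useful_rate t) * ennreal C \<partial>lborel)"
    by (intro nn_integral_mono mult_left_mono ennreal_leI) auto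
  also have "\<dots> = (\<integral>\<^sup>+ t. ennreal (Opt.useful_rate t) \<partial>lborel) * ennreal C"
    by (rule nn_integral_multc) simp
  also have "\<dots> \<le> (\<Sum>j<N. ennreal (w j)) * ennreal C"
    by (intro mult_right_mono Opt.total_useful_work_le) auto
  also have "\<dots> < \<infinity>" by (simp add: ennreal_mult_less_top)
  finally show ?thesis .
qed

theorem srpt_cost_le:
  "cost (\<lambda>s. s powr \<alpha>) N a w m sp asg
    \<le> ennreal (2 * max 2 (2 * \<alpha> - 1)) * cost (\<lambda>s. s powr \<alpha>) N a w m sp' asg'"
proof -
  define c where "c = max 2 (2 * \<alpha> - 1)"
  define F where "F t = real (n' t) + (\<Sum>k<m. sp' k t powr \<alpha>)" for t
  have "0 \<le> c" by (simp add: c_def)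
  have "0 \<le> F t" for t unfolding F_def by (intro add_nonneg_nonneg sum_nonneg) auto
  have [measurable]: "F \<in> borel_measurable borel" unfolding F_def by measurable
  have amortized: "ennreal (n t) + ennreal (Opt.useful_rate t) * ennreal (opt_weight t)
      \<le> ennreal c * ennreal (F t) + ennreal (Alg.useful_rate t) * ennreal (alg_weight t)" for t
  proof -
    have "ennreal (n t + Opt.useful_rate t * opt_weight t)
        \<le> ennreal (c * F t + Alg.useful_rate t * alg_weight t)"
      using running_cost_le[of t] by (intro ennreal_leI) (simp add: F_def c_def mult.commute)
    then show ?thesis
      using \<open>0 \<le> c\<close> \<open>0 \<le> F t\<close> Alg.useful_rate_nonneg Opt.useful_rate_nonneg weight_nonneg
      by (simp add: ennreal_plus ennreal_mult)
  qed
  have "(\<integral>\<^sup>+ t. ennreal (n t) \<partial>lborel) \<le> (\<integral>\<^sup>+ t. ennreal c * ennreal (F t) \<partial>lborel)"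
    by (rule nn_integral_le_if_amortized[OF _ _ _ _ amortized weighted_work_le weighted_work_finite])
      simp_all
  also have "\<dots> = ennreal c * cost (\<lambda>s. s powr \<alpha>) N a w m sp' asg'"
    unfolding cost_def num_alive_def F_def[symmetric] by (rule nn_integral_cmult) simp
  finally have "2 * (\<integral>\<^sup>+ t. ennreal (n t) \<partial>lborel)
      \<le> 2 * (ennreal c * cost (\<lambda>s. s powr \<alpha>) N a w m sp' asg')"
    by (intro mult_left_mono) auto
  then show ?thesis
    unfolding Alg.cost_srpt c_def[symmetric] using \<open>0 \<le> c\<close> by (simp add: ennreal_mult mult.assoc)
qed

end

theorem theorem2:
  fixes alpha :: real and m N :: nat and a w :: "nat \<Rightarrow> real"
    and sp sp' :: "nat \<Rightarrow> real \<Rightarrow> real" and asg asg' :: "real \<Rightarrow> nat \<Rightarrow> nat option"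
  assumes "1 < alpha" and "alpha < 2" and "1 \<le> m"
    and "\<forall>j<N. 0 < w j"
    and "feasible_schedule N a m sp asg"
    and "srpt_rule alpha N a w m sp asg"
    and "feasible_schedule N a m sp' asg'"
  shows "cost (\<lambda>s. s powr alpha) N a w m sp asg
           \<le> ennreal (3 + 2 / (2 - alpha)) * cost (\<lambda>s. s powr alpha) N a w m sp' asg'"
proof (cases "cost (\<lambda>s. s powr alpha) N a w m sp' asg' < \<infinity>")
  case True
  interpret srpt_comparison N m a w sp sp' asg asg' alpha
    using assms True by unfold_locales auto
  note srpt_cost_le
  also have "ennreal (2 * max 2 (2 * alpha - 1)) * cost (\<lambda>s. s powr alpha) N a w m sp' asg'
      \<le> ennreal (3 + 2 / (2 - alpha)) * cost (\<lambda>s. s powr alpha) N a w m sp' asg'"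
    using assms(1,2) by (intro mult_right_mono ennreal_leI max_le_competitive_ratio) auto
  finally show ?thesis .
next
  case False
  moreover have "0 < 3 + 2 / (2 - alpha)" using assms(2) by (simp add: add_pos_pos)
  ultimately show ?thesis by (simp add: ennreal_mult_eq_top_iff not_less top_unique)
qed

end
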